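(* Let $G$ be a connected vertex-transitive simple graph in which every vertex has even valence, and let $H$ be obtained from $G$ by deleting a vertex $v$ and then partitioning the neighbors of $v$ into pairs in any way and adding an edge between the two vertices of each pair. Then $\operatorname{gon}(H)\le\operatorname{gon}(G)$.
   Context: Graphs are finite, connected, loopless multigraphs (so $H$ may have parallel edges). A divisor on $G$ is a function $D:V(G)\to\mathbb{Z}$; effective if all values are $\ge0$; degree $\sum_vD(v)$. Firing a vertex $v$ moves one chip from $v$ along each incident edge to its other endpoint; divisors are equivalent if related by a sequence of firings. $D$ has positive rank if for every vertex $q$, $D-q$ is equivalent to an effective divisor. $\operatorname{gon}(G)$ is the minimum degree of a positive rank divisor. *)

theory Defs
  imports Main "HOL-Library.Multiset" "HOL-Library.Disjoint_Sets"
begin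

text \<open>An edge is the set of its two endpoints; parallel edges are repeated elements of the
  multiset of edges.\<close>

record 'a multigraph =
  verts :: "'a set"
  edges :: "'a set multiset"

definition finite_loopless_multigraph :: "'a multigraph \<Rightarrow> bool" where
  "finite_loopless_multigraph G \<longleftrightarrow>
     finite (verts G) \<and> (\<forall>e \<in># edges G. e \<subseteq> verts G \<and> card e = 2)"

definition adjacent :: "'a multigraph \<Rightarrow> 'a \<Rightarrow> 'a \<Rightarrow> bool" where
  "adjacent G u w \<longleftrightarrow> {u, w} \<in># edges G"

definition connected_multigraph :: "'a multigraph \<Rightarrow> bool" where
  "connected_multigraph G \<longleftrightarrow> (\<forall>u \<in> verts G. \<forall>w \<in> verts G. rtranclp (adjacent G) u w)"

definition simple_multigraph :: "'a multigraph \<Rightarrow> bool" where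
  "simple_multigraph G \<longleftrightarrow> (\<forall>e. count (edges G) e \<le> 1)"

definition neighbors :: "'a multigraph \<Rightarrow> 'a \<Rightarrow> 'a set" where
  "neighbors G v = {w \<in> verts G. adjacent G v w}"

definition valence :: "'a multigraph \<Rightarrow> 'a \<Rightarrow> nat" where
  "valence G v = size {#e \<in># edges G. v \<in> e#}"

text \<open>A vertex bijection preserving all edge multiplicities; only its values on the vertices
  matter.\<close>

definition automorphism :: "'a multigraph \<Rightarrow> ('a \<Rightarrow> 'a) \<Rightarrow> bool" where
  "automorphism G f \<longleftrightarrow>
     bij_betw f (verts G) (verts G) \<and> image_mset (image f) (edges G) = edges G"

definition vertex_transitive :: "'a multigraph \<Rightarrow> bool" where
  "vertex_transitive G \<longleftrightarrow>
     (\<forall>u \<in> verts G. \<forall>w \<in> verts G. \<exists>f. automorphism G f \<and> f u = w)"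

text \<open>A function from the vertices to the integers is encoded as a total function that is zero
  off the vertex set.\<close>

definition divisor :: "'a multigraph \<Rightarrow> ('a \<Rightarrow> int) \<Rightarrow> bool" where
  "divisor G D \<longleftrightarrow> (\<forall>x. x \<notin> verts G \<longrightarrow> D x = 0)"

definition effective :: "'a multigraph \<Rightarrow> ('a \<Rightarrow> int) \<Rightarrow> bool" where
  "effective G D \<longleftrightarrow> (\<forall>x \<in> verts G. 0 \<le> D x)"

definition degree :: "'a multigraph \<Rightarrow> ('a \<Rightarrow> int) \<Rightarrow> int" where
  "degree G D = (\<Sum>x \<in> verts G. D x)"

definition fire :: "'a multigraph \<Rightarrow> 'a \<Rightarrow> ('a \<Rightarrow> int) \<Rightarrow> ('a \<Rightarrow> int)" where
  "fire G v D = (\<lambda>w. if w = v then D v - int (valence G v)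
                      else D w + int (count (edges G) {v, w}))"

text \<open>Firing every vertex once changes nothing, so firing all the other vertices undoes the firing
  of a given vertex; hence the reflexive transitive closure is already symmetric.\<close>

definition equivalent :: "'a multigraph \<Rightarrow> ('a \<Rightarrow> int) \<Rightarrow> ('a \<Rightarrow> int) \<Rightarrow> bool" where
  "equivalent G = rtranclp (\<lambda>D D'. \<exists>v \<in> verts G. D' = fire G v D)"

definition positive_rank :: "'a multigraph \<Rightarrow> ('a \<Rightarrow> int) \<Rightarrow> bool" where
  "positive_rank G D \<longleftrightarrow>
     (\<forall>q \<in> verts G. \<exists>D'. equivalent G (D(q := D q - 1)) D' \<and> effective G D')"

text \<open>The minimum exists for every finite loopless multigraph: firing preserves the degree, so
  degrees of positive rank divisors are nonnegative, and the divisor with one chip on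
  each vertex has positive rank. For the graph without vertices the value is 0.\<close>

definition gon :: "'a multigraph \<Rightarrow> int" where
  "gon G = (LEAST d. \<exists>D. divisor G D \<and> positive_rank G D \<and> degree G D = d)"

definition pairing :: "'a set \<Rightarrow> 'a set set \<Rightarrow> bool" where
  "pairing A P \<longleftrightarrow> partition_on A P \<and> (\<forall>p \<in> P. card p = 2)"

text \<open>Each pair in \<open>P\<close> is itself the new edge joining its two elements; the multiset sum creates a
  parallel edge when they are already adjacent.\<close>

definition delete_and_pair :: "'a multigraph \<Rightarrow> 'a \<Rightarrow> 'a set set \<Rightarrow> 'a multigraph" where
  "delete_and_pair G v P =
     \<lparr>verts = verts G - {v}, edges = {#e \<in># edges G. v \<notin> e#} + mset_set P\<rparr>"

end

theory Submission
  imports Defs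
begin

text \<open>Let \<open>D\<close> be an effective divisor of positive rank on \<open>G\<close>. For a vertex \<open>q\<close> let \<open>h q\<close> be the
  least value of \<open>max g - g q\<close> over the firing scripts \<open>g\<close> that keep \<open>D\<close> effective and put a chip
  on \<open>q\<close>. Replacing \<open>g\<close> by \<open>max g c\<close> keeps \<open>D\<close> effective, so if \<open>h\<close> is maximal at \<open>v\<close>, the
  optimal script for any \<open>q\<close> takes at \<open>v\<close> a value no larger than at the neighbors of \<open>v\<close>:
  otherwise truncating it at its value at \<open>v\<close> would give \<open>h v < h q\<close>. For such a script,
  replacing the edges \<open>uv\<close>, \<open>u'v\<close> by \<open>uu'\<close> changes the number of chips on \<open>u\<close> by
  \<open>g u' - g v \<ge> 0\<close>, so the restriction of \<open>D\<close> has positive rank on \<open>H\<close>. By transitivity the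
  deleted vertex may be taken to be this \<open>v\<close>.\<close>

section \<open>Firing scripts and the Laplacian\<close>

text \<open>A firing script \<open>f\<close> fires each vertex \<open>x\<close> exactly
  \<open>f x\<close> times, negative values meaning reverse firing. The value at \<open>w\<close> is
  the net number of chips that \<open>w\<close> loses, so the script turns \<open>D\<close> into
  \<open>D - laplacian G f\<close>.\<close>

definition laplacian :: "'a multigraph \<Rightarrow> ('a \<Rightarrow> int) \<Rightarrow> 'a \<Rightarrow> int" where
  "laplacian G f w = (\<Sum>x \<in> verts G. int (count (edges G) {w, x}) * (f w - f x))"

lemma laplacian_add: "laplacian G (\<lambda>x. f x + g x) w = laplacian G f w + laplacian G g w"
  unfolding laplacian_def sum.distrib[symmetric] by (simp add: algebra_simps)

lemma laplacian_diff: "laplacian G (\<lambda>x. f x - g x) w = laplacian G f w - laplacian G g w"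
  unfolding laplacian_def sum_subtractf[symmetric] by (simp add: algebra_simps)

lemma laplacian_const: "laplacian G (\<lambda>x. c) w = 0"
  by (simp add: laplacian_def)

lemma laplacian_cong:
  assumes "\<And>x. x \<in> verts G \<Longrightarrow> f x = g x" "w \<in> verts G"
  shows "laplacian G f w = laplacian G g w"
  using assms by (simp add: laplacian_def)

text \<open>Raising a script away from \<open>x\<close> only sends more chips to \<open>x\<close>:
  each difference \<open>f x - f y\<close> shrinks.\<close>

lemma laplacian_antimono:
  assumes "\<And>y. y \<in> verts G \<Longrightarrow> f y \<le> g y" "g x = f x"
  shows "laplacian G g x \<le> laplacian G f x"
  unfolding laplacian_def using assms by (intro sum_mono mult_left_mono) auto

text \<open>Multiplicities are symmetric, so what one endpoint of an edge loses the other gains;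
  hence firing preserves the degree.\<close>

lemma sum_laplacian: "(\<Sum>w \<in> verts G. laplacian G f w) = 0"
proof -
  let ?c = "\<lambda>w x. int (count (edges G) {w, x})"
  have "(\<Sum>w \<in> verts G. \<Sum>x \<in> verts G. ?c w x * f w) = (\<Sum>w \<in> verts G. \<Sum>x \<in> verts G. ?c w x * f x)"
    by (subst sum.swap) (simp add: insert_commute)
  then show ?thesis
    by (simp add: laplacian_def right_diff_distrib sum_subtractf)
qed

lemma degree_diff_laplacian: "degree G (\<lambda>x. D x - laplacian G f x) = degree G D"
  by (simp add: degree_def sum_subtractf sum_laplacian)

lemma count_edges_off_verts:
  assumes "finite_loopless_multigraph G" "w \<notin> verts G"
  shows "count (edges G) {w, x} = 0"
  using assms unfolding finite_loopless_multigraph_def count_eq_zero_iff by blast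

lemma laplacian_off_verts:
  assumes "finite_loopless_multigraph G" "w \<notin> verts G"
  shows "laplacian G f w = 0"
  using count_edges_off_verts[OF assms] by (simp add: laplacian_def)

lemma count_loop:
  assumes "finite_loopless_multigraph G"
  shows "count (edges G) {w, w} = 0"
  using assms unfolding finite_loopless_multigraph_def count_eq_zero_iff by force

lemma valence_eq_sum:
  assumes G: "finite_loopless_multigraph G"
  shows "valence G v = (\<Sum>x \<in> verts G. count (edges G) {v, x})"
proof -
  let ?E = "{e \<in> set_mset (edges G). v \<in> e}"
  have fin: "finite (verts G)"
    using G by (simp add: finite_loopless_multigraph_def)
  have inj: "inj_on (\<lambda>x. {v, x}) (verts G)"
    by (auto simp: inj_on_def doubleton_eq_iff)
  \<comment> \<open>Every edge at \<open>v\<close> has the form \<open>{v, x}\<close>; pairs that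
    are not edges have count 0 and may be added to the sum.\<close>
  have sub: "?E \<subseteq> (\<lambda>x. {v, x}) ` verts G"
  proof
    fix e assume e: "e \<in> ?E"
    then have "e \<subseteq> verts G" "card e = 2" "v \<in> e"
      using G by (auto simp: finite_loopless_multigraph_def)
    then show "e \<in> (\<lambda>x. {v, x}) ` verts G"
      by (auto simp: card_2_iff insert_commute)
  qed
  have "valence G v = (\<Sum>e \<in> ?E. count (edges G) e)"
    unfolding valence_def size_multiset_overloaded_eq by (intro sum.cong) auto
  also have "\<dots> = (\<Sum>e \<in> (\<lambda>x. {v, x}) ` verts G. count (edges G) e)"
    using sub fin by (intro sum.mono_neutral_left) (auto simp: count_eq_zero_iff)
  also have "\<dots> = (\<Sum>x \<in> verts G. count (edges G) {v, x})"
    using inj by (simp add: sum.reindex)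
  finally show ?thesis .
qed

lemma fire_eq_laplacian:
  assumes G: "finite_loopless_multigraph G" and v: "v \<in> verts G"
  shows "fire G v D = (\<lambda>w. D w - laplacian G (\<lambda>x. if x = v then 1 else 0) w)"
proof
  fix w
  have fin: "finite (verts G)"
    using G by (simp add: finite_loopless_multigraph_def)
  show "fire G v D w = D w - laplacian G (\<lambda>x. if x = v then 1 else 0) w"
  proof (cases "w = v")
    case True
    have "laplacian G (\<lambda>x. if x = v then 1 else 0) v = (\<Sum>x \<in> verts G. int (count (edges G) {v, x}))"
      unfolding laplacian_def using count_loop[OF G] by (intro sum.cong) auto
    then show ?thesis
      using True by (simp add: fire_def valence_eq_sum[OF G])
  next
    case False
    then have "laplacian G (\<lambda>x. if x = v then 1 else 0) w
        = (\<Sum>x \<in> verts G. if x = v then - int (count (edges G) {w, x}) else 0)"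
      unfolding laplacian_def by (intro sum.cong) auto
    also have "\<dots> = - int (count (edges G) {v, w})"
      using fin v by (simp add: insert_commute)
    finally show ?thesis
      using False by (simp add: fire_def)
  qed
qed

section \<open>Equivalence and positive rank in terms of scripts\<close>

lemma equivalent_trans:
  "equivalent G D E \<Longrightarrow> equivalent G E F \<Longrightarrow> equivalent G D F"
  unfolding equivalent_def by simp

lemma equivalent_fire: "v \<in> verts G \<Longrightarrow> equivalent G D (fire G v D)"
  unfolding equivalent_def by (rule r_into_rtranclp) blast

lemma equivalent_imp_laplacian:
  assumes G: "finite_loopless_multigraph G" and "equivalent G D D'"
  shows "\<exists>f. D' = (\<lambda>x. D x - laplacian G f x)"
  using assms(2) unfolding equivalent_def
proof (induction rule: rtranclp_induct)
  case base
  show ?case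
    by (rule exI[of _ "\<lambda>x. 0"]) (simp add: laplacian_const)
next
  case (step E F)
  then obtain f v where f: "E = (\<lambda>x. D x - laplacian G f x)"
    and v: "v \<in> verts G" "F = fire G v E"
    by blast
  show ?case
    by (rule exI[of _ "\<lambda>x. f x + (if x = v then 1 else 0)"])
      (simp only: v(2) fire_eq_laplacian[OF G v(1)] laplacian_add f diff_diff_eq)
qed

text \<open>Firings realize only nonnegative scripts, built up vertex by vertex. Adding a constant
  to \<open>f\<close> makes it nonnegative and leaves its Laplacian unchanged.\<close>

lemma laplacian_imp_equivalent:
  assumes G: "finite_loopless_multigraph G"
  shows "equivalent G D (\<lambda>x. D x - laplacian G f x)"
proof -
  have fin: "finite (verts G)"
    using G by (simp add: finite_loopless_multigraph_def)
  have fire_many: "equivalent G E (\<lambda>w. E w - laplacian G (\<lambda>x. if x = v then int n else 0) w)"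
    if v: "v \<in> verts G" for E v n
  proof (induction n)
    case 0
    have "(\<lambda>x. if x = v then int 0 else 0) = (\<lambda>x. 0)"
      by auto
    then show ?case
      by (simp only: laplacian_const) (simp add: equivalent_def)
  next
    case (Suc n)
    let ?F = "\<lambda>w. E w - laplacian G (\<lambda>x. if x = v then int n else 0) w"
    have "(\<lambda>x. if x = v then int (Suc n) else 0)
        = (\<lambda>x. (if x = v then int n else 0) + (if x = v then 1 else 0))"
      by auto
    then have "fire G v ?F = (\<lambda>w. E w - laplacian G (\<lambda>x. if x = v then int (Suc n) else 0) w)"
      by (simp only: fire_eq_laplacian[OF G v] laplacian_add diff_diff_eq)
    then show ?case
      using equivalent_trans[OF Suc equivalent_fire[OF v]] by simp
  qed
  have nonneg: "equivalent G D (\<lambda>w. D w - laplacian G (\<lambda>x. if x \<in> S then int (n x) else 0) w)"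
    if "S \<subseteq> verts G" for S n
    using finite_subset[OF that fin] that
  proof (induction S)
    case empty
    show ?case
      by (simp add: laplacian_const equivalent_def)
  next
    case (insert v S)
    have "(\<lambda>x. if x \<in> insert v S then int (n x) else 0)
        = (\<lambda>x. (if x \<in> S then int (n x) else 0) + (if x = v then int (n v) else 0))"
      using insert.hyps by auto
    then show ?case
      using equivalent_trans[OF insert.IH fire_many[of v _ "n v"]] insert.prems
      by (simp only: laplacian_add diff_diff_eq) auto
  qed
  \<comment> \<open>The sum of the absolute values dominates each \<open>- f x\<close>.\<close>
  define c where "c = (\<Sum>x \<in> verts G. \<bar>f x\<bar>)"
  have c: "0 \<le> f x + c" if "x \<in> verts G" for x
    using member_le_sum[of x "verts G" "\<lambda>x. \<bar>f x\<bar>"] that fin by (simp add: c_def)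
  have "laplacian G (\<lambda>x. if x \<in> verts G then int (nat (f x + c)) else 0) w = laplacian G f w" for w
  proof (cases "w \<in> verts G")
    case True
    have "laplacian G (\<lambda>x. if x \<in> verts G then int (nat (f x + c)) else 0) w
        = laplacian G (\<lambda>x. f x + c) w"
      using c True by (intro laplacian_cong) auto
    then show ?thesis
      by (simp add: laplacian_add laplacian_const)
  qed (simp add: laplacian_off_verts[OF G])
  then show ?thesis
    using nonneg[of "verts G" "\<lambda>x. nat (f x + c)"] by simp
qed

text \<open>Over the integers, effectiveness of \<open>D - q\<close> after the script means that at
  least one chip of \<open>D\<close> is left on \<open>q\<close>, which is the strict
  inequality.\<close>

lemma positive_rank_iff:
  assumes G: "finite_loopless_multigraph G"
  shows "positive_rank G D \<longleftrightarrow> (\<forall>q \<in> verts G. \<exists>g.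
    (\<forall>x \<in> verts G. laplacian G g x \<le> D x) \<and> laplacian G g q < D q)"
proof -
  have "(\<exists>D'. equivalent G (D(q := D q - 1)) D' \<and> effective G D') \<longleftrightarrow>
      (\<exists>g. (\<forall>x \<in> verts G. laplacian G g x \<le> D x) \<and> laplacian G g q < D q)" (is "?L \<longleftrightarrow> ?R")
    if q: "q \<in> verts G" for q
  proof
    assume ?L
    then obtain g where g: "\<And>x. x \<in> verts G \<Longrightarrow> 0 \<le> (D(q := D q - 1)) x - laplacian G g x"
      by (metis equivalent_imp_laplacian[OF G] effective_def)
    have "laplacian G g x \<le> D x" if "x \<in> verts G" for x
      using g[OF that] by (simp split: if_splits)
    moreover have "laplacian G g q < D q"
      using g[OF q] by simp
    ultimately show ?R
      by blast
  next
    assume ?R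
    then obtain g where "\<forall>x \<in> verts G. laplacian G g x \<le> D x" "laplacian G g q < D q"
      by blast
    then have "effective G (\<lambda>x. (D(q := D q - 1)) x - laplacian G g x)"
      by (auto simp: effective_def)
    then show ?L
      using laplacian_imp_equivalent[OF G] by blast
  qed
  then show ?thesis
    by (simp add: positive_rank_def)
qed

section \<open>Gonality as an attained minimum\<close>

lemma positive_rank_degree_nonneg:
  assumes G: "finite_loopless_multigraph G" and D: "positive_rank G D"
  shows "0 \<le> degree G D"
proof (cases "verts G = {}")
  case True
  then show ?thesis
    by (simp add: degree_def)
next
  case False
  then obtain g where "\<forall>x \<in> verts G. laplacian G g x \<le> D x"
    using D positive_rank_iff[OF G] by blast
  then have "0 \<le> degree G (\<lambda>x. D x - laplacian G g x)"
    by (simp add: degree_def sum_nonneg)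
  then show ?thesis
    by (simp add: degree_diff_laplacian)
qed

text \<open>The integers are not well-ordered, so the least element is found among the natural
  numbers and transferred back.\<close>

lemma Least_int_bounded_below:
  fixes Q :: "int \<Rightarrow> bool"
  assumes "Q d" and nonneg: "\<And>e. Q e \<Longrightarrow> 0 \<le> e"
  shows "Q (LEAST e. Q e)" "(LEAST e. Q e) \<le> d"
proof -
  define n where "n = (LEAST n. Q (int n))"
  have "Q (int (nat d))"
    using assms by simp
  then have n: "Q (int n)"
    unfolding n_def by (rule LeastI)
  have le: "int n \<le> e" if "Q e" for e
    using Least_le[of "\<lambda>n. Q (int n)" "nat e"] that nonneg[OF that] by (simp add: n_def)
  have "(LEAST e. Q e) = int n"
    using n le by (rule Least_equality)
  then show "Q (LEAST e. Q e)" "(LEAST e. Q e) \<le> d"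
    using n le assms(1) by auto
qed

lemma
  assumes G: "finite_loopless_multigraph G" and D: "divisor G D" "positive_rank G D"
  shows gon_le: "gon G \<le> degree G D"
    and gon_attained: "\<exists>E. divisor G E \<and> positive_rank G E \<and> degree G E = gon G"
proof -
  let ?Q = "\<lambda>d. \<exists>E. divisor G E \<and> positive_rank G E \<and> degree G E = d"
  have Q: "?Q (degree G D)"
    using D by blast
  have nonneg: "0 \<le> d" if "?Q d" for d
    using that positive_rank_degree_nonneg[OF G] by blast
  show "gon G \<le> degree G D"
    unfolding gon_def by (rule Least_int_bounded_below(2)[of ?Q, OF Q nonneg])
  show "?Q (gon G)"
    unfolding gon_def by (rule Least_int_bounded_below(1)[of ?Q, OF Q nonneg])
qed

lemma exists_positive_rank:
  assumes G: "finite_loopless_multigraph G"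
  obtains D where "divisor G D" "positive_rank G D"
proof -
  \<comment> \<open>One chip on each vertex; the zero script already serves every
    \<open>q\<close>.\<close>
  let ?D = "\<lambda>x. if x \<in> verts G then 1 else 0"
  have "positive_rank G ?D"
    unfolding positive_rank_iff[OF G]
    by (auto intro!: exI[of _ "\<lambda>x. 0"] simp: laplacian_const)
  moreover have "divisor G ?D"
    by (simp add: divisor_def)
  ultimately show thesis
    using that by blast
qed

text \<open>Any script witnessing positive rank leads to an effective divisor. Relative to the new
  divisor, a script \<open>f\<close> for \<open>D\<close> becomes \<open>f - g\<close>.\<close>

lemma positive_rank_effective_representative:
  assumes G: "finite_loopless_multigraph G" and D: "positive_rank G D"
  obtains E where "effective G E" "positive_rank G E" "degree G E = degree G D"
proof (cases "verts G = {}")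
  case True
  then show ?thesis
    using that[of D] D by (simp add: effective_def)
next
  case False
  then obtain g where g: "\<forall>x \<in> verts G. laplacian G g x \<le> D x"
    using D positive_rank_iff[OF G] by blast
  let ?E = "\<lambda>x. D x - laplacian G g x"
  have "positive_rank G ?E"
    unfolding positive_rank_iff[OF G]
  proof
    fix q assume "q \<in> verts G"
    then obtain f where "\<forall>x \<in> verts G. laplacian G f x \<le> D x" "laplacian G f q < D q"
      using D positive_rank_iff[OF G] by blast
    then show "\<exists>f. (\<forall>x \<in> verts G. laplacian G f x \<le> ?E x) \<and> laplacian G f q < ?E q"
      by (intro exI[of _ "\<lambda>x. f x - g x"]) (simp add: laplacian_diff)
  qed
  then show ?thesis
    using that[of ?E] g by (simp add: effective_def degree_diff_laplacian)
qed

section \<open>Truncated scripts and avoidable vertices\<close>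

text \<open>Where \<open>g\<close> is at least \<open>c\<close>, its value is kept while others only
  rise, so no more chips are lost. Where \<open>g\<close> is below \<open>c\<close>, the vertex
  becomes a minimum of the truncated script and loses nothing.\<close>

lemma laplacian_max_const_le:
  assumes "effective G D" "\<forall>x \<in> verts G. laplacian G g x \<le> D x" "x \<in> verts G"
  shows "laplacian G (\<lambda>x. max (g x) c) x \<le> D x"
proof (cases "c \<le> g x")
  case True
  then have "laplacian G (\<lambda>x. max (g x) c) x \<le> laplacian G g x"
    by (intro laplacian_antimono) auto
  then show ?thesis
    using assms by force
next
  case False
  then have "laplacian G (\<lambda>x. max (g x) c) x \<le> laplacian G (\<lambda>x. c) x"
    by (intro laplacian_antimono) auto
  then show ?thesis
    using assms(1,3) by (fastforce simp: laplacian_const effective_def)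
qed

text \<open>A vertex is avoidable for \<open>D\<close> if every vertex can be given a chip by a script along which
  it never passes chips on.\<close>

definition avoidable :: "'a multigraph \<Rightarrow> ('a \<Rightarrow> int) \<Rightarrow> 'a \<Rightarrow> bool" where
  "avoidable G D v \<longleftrightarrow> (\<forall>q \<in> verts G. \<exists>g. (\<forall>x \<in> verts G. laplacian G g x \<le> D x) \<and>
     laplacian G g q < D q \<and> (\<forall>u \<in> neighbors G v. g v \<le> g u))"

lemma exists_avoidable:
  assumes G: "finite_loopless_multigraph G" and ne: "verts G \<noteq> {}"
    and D: "effective G D" "positive_rank G D"
  obtains v where "v \<in> verts G" "avoidable G D v"
proof -
  have fin: "finite (verts G)"
    using G by (simp add: finite_loopless_multigraph_def)
  \<comment> \<open>\<open>k\<close> bounds how far the script rises above its value at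
    \<open>q\<close>, so the least such \<open>k\<close> is the height \<open>h q\<close> of the
    overview.\<close>
  define reach where "reach q k \<longleftrightarrow> (\<exists>g. (\<forall>x \<in> verts G. laplacian G g x \<le> D x) \<and>
    laplacian G g q < D q \<and> (\<forall>x \<in> verts G. g x \<le> g q + int k))" for q k
  define h where "h q = (LEAST k. reach q k)" for q
  have reach_h: "reach q (h q)" if q: "q \<in> verts G" for q
  proof -
    obtain g where g: "\<forall>x \<in> verts G. laplacian G g x \<le> D x" "laplacian G g q < D q"
      using D(2) q positive_rank_iff[OF G] by blast
    have "g x \<le> g q + int (nat (Max (g ` verts G) - g q))" if "x \<in> verts G" for x
    proof -
      have "g x \<le> Max (g ` verts G)"
        using that fin by (intro Max_ge) auto
      then show ?thesis
        by linarith
    qed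
    then have "reach q (nat (Max (g ` verts G) - g q))"
      unfolding reach_def using g by blast
    then show ?thesis
      unfolding h_def by (rule LeastI)
  qed
  have "Max (h ` verts G) \<in> h ` verts G"
    using fin ne by (intro Max_in) auto
  then obtain v where v: "v \<in> verts G" "Max (h ` verts G) = h v"
    by blast
  have hv: "h q \<le> h v" if "q \<in> verts G" for q
    unfolding v(2)[symmetric] using fin that by (intro Max_ge) auto
  have "avoidable G D v"
    unfolding avoidable_def
  proof
    fix q assume q: "q \<in> verts G"
    obtain g0 where g0: "\<forall>x \<in> verts G. laplacian G g0 x \<le> D x" "laplacian G g0 q < D q"
      "\<forall>x \<in> verts G. g0 x \<le> g0 q + int (h q)"
      using reach_h[OF q] unfolding reach_def by blast
    \<comment> \<open>Truncating at the value at \<open>q\<close> makes \<open>q\<close> a minimum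
      of the script and keeps both the chip on \<open>q\<close> and the bound
      \<open>h q\<close>.\<close>
    define g where "g x = max (g0 x) (g0 q)" for x
    have g: "\<forall>x \<in> verts G. laplacian G g x \<le> D x"
      unfolding g_def using laplacian_max_const_le[OF D(1) g0(1)] by blast
    have "laplacian G g q \<le> laplacian G g0 q"
      by (intro laplacian_antimono) (auto simp: g_def)
    then have gq: "laplacian G g q < D q"
      using g0(2) by simp
    have gk: "g x \<le> g q + int (h q)" if "x \<in> verts G" for x
      using g0(3) that by (simp add: g_def)
    have gmin: "g q \<le> g x" for x
      by (simp add: g_def)
    have "g v \<le> g u" if u: "u \<in> neighbors G v" for u
    proof (rule ccontr)
      assume less: "\<not> g v \<le> g u"
      have uV: "u \<in> verts G" and adj: "0 < count (edges G) {v, u}"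
        using u by (auto simp: neighbors_def adjacent_def)
      define f where "f x = max (g x) (g v)" for x
      have f: "\<forall>x \<in> verts G. laplacian G f x \<le> D x"
        unfolding f_def using laplacian_max_const_le[OF D(1) g] by blast
      \<comment> \<open>The term of \<open>u\<close> drops from a positive amount to 0, so a chip
        stays on \<open>v\<close> and \<open>f\<close> is a script for \<open>v\<close>.\<close>
      have "laplacian G f v < laplacian G g v"
        unfolding laplacian_def
      proof (rule sum_strict_mono_ex1[OF fin])
        show "\<forall>x \<in> verts G. int (count (edges G) {v, x}) * (f v - f x)
            \<le> int (count (edges G) {v, x}) * (g v - g x)"
          by (intro ballI mult_left_mono) (auto simp: f_def)
        show "\<exists>x \<in> verts G. int (count (edges G) {v, x}) * (f v - f x)
            < int (count (edges G) {v, x}) * (g v - g x)"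
          using less adj by (intro bexI[OF _ uV] mult_strict_left_mono) (auto simp: f_def)
      qed
      then have fv: "laplacian G f v < D v"
        using g v(1) by force
      \<comment> \<open>As \<open>g v > g u \<ge> g q\<close>, the value at \<open>v\<close> lies at
        least 1 above the minimum. This lowers the bound by 1, and positivity keeps the natural
        subtraction \<open>h q - 1\<close> exact.\<close>
      have "0 < h q"
        using gk[OF v(1)] gmin[of u] less by simp
      then have "f x \<le> f v + int (h q - 1)" if "x \<in> verts G" for x
        using gk[OF that] gmin[of u] less by (simp add: f_def)
      then have "reach v (h q - 1)"
        unfolding reach_def using f fv by blast
      then have "h v \<le> h q - 1"
        unfolding h_def by (rule Least_le)
      then show False
        using hv[OF q] \<open>0 < h q\<close> by simp
    qed
    then show "\<exists>g. (\<forall>x \<in> verts G. laplacian G g x \<le> D x) \<and>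
        laplacian G g q < D q \<and> (\<forall>u \<in> neighbors G v. g v \<le> g u)"
      using g gq by blast
  qed
  then show thesis
    using that v(1) by blast
qed

section \<open>Transport along automorphisms\<close>

lemma count_edges_automorphism:
  assumes G: "finite_loopless_multigraph G" and \<phi>: "automorphism G \<phi>"
    and xy: "x \<in> verts G" "y \<in> verts G"
  shows "count (edges G) {\<phi> x, \<phi> y} = count (edges G) {x, y}"
proof -
  have inj: "inj_on \<phi> (verts G)"
    using \<phi> by (auto simp: automorphism_def bij_betw_def)
  \<comment> \<open>Injectivity of \<open>\<phi>\<close> on the vertices leaves
    \<open>{x, y}\<close> as the only edge that can map to its image.\<close>
  have "image \<phi> -` {\<phi> ` {x, y}} \<inter> set_mset (edges G) = {{x, y}} \<inter> set_mset (edges G)"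
  proof -
    have "e = {x, y}" if "e \<in># edges G" "\<phi> ` e = \<phi> ` {x, y}" for e
      using that G xy inj inj_on_image_eq_iff[OF inj, of e "{x, y}"]
      by (auto simp: finite_loopless_multigraph_def)
    then show ?thesis
      by auto
  qed
  then have "count (image_mset (image \<phi>) (edges G)) (\<phi> ` {x, y})
      = (\<Sum>e \<in> {{x, y}} \<inter> set_mset (edges G). count (edges G) e)"
    by (simp add: count_image_mset)
  also have "\<dots> = count (edges G) {x, y}"
    by (cases "{x, y} \<in># edges G") (simp_all add: count_eq_zero_iff)
  finally show ?thesis
    using \<phi> by (simp add: automorphism_def)
qed

lemma laplacian_automorphism:
  assumes G: "finite_loopless_multigraph G" and \<phi>: "automorphism G \<phi>" and w: "w \<in> verts G"
  shows "laplacian G (g \<circ> \<phi>) w = laplacian G g (\<phi> w)"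
proof -
  have "laplacian G g (\<phi> w)
      = (\<Sum>x \<in> verts G. int (count (edges G) {\<phi> w, \<phi> x}) * (g (\<phi> w) - g (\<phi> x)))"
    unfolding laplacian_def using \<phi>
    by (intro sum.reindex_bij_betw[symmetric]) (simp add: automorphism_def)
  also have "\<dots> = laplacian G (g \<circ> \<phi>) w"
    unfolding laplacian_def using count_edges_automorphism[OF G \<phi> w] by simp
  finally show ?thesis ..
qed

text \<open>Scripts for \<open>D\<close> pull back to scripts \<open>g \<circ> \<phi>\<close> for
  \<open>D \<circ> \<phi>\<close>, and \<open>\<phi>\<close> maps neighbors of \<open>v\<close> to
  neighbors of \<open>\<phi> v\<close>.\<close>

lemma avoidable_automorphism:
  assumes G: "finite_loopless_multigraph G" and \<phi>: "automorphism G \<phi>" and v: "v \<in> verts G"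
    and av: "avoidable G D (\<phi> v)"
  shows "avoidable G (D \<circ> \<phi>) v"
  unfolding avoidable_def
proof
  fix q assume q: "q \<in> verts G"
  have \<phi>V: "\<phi> x \<in> verts G" if "x \<in> verts G" for x
    using \<phi> that by (auto simp: automorphism_def bij_betw_def)
  obtain g where g: "\<forall>x \<in> verts G. laplacian G g x \<le> D x" "laplacian G g (\<phi> q) < D (\<phi> q)"
    "\<forall>u \<in> neighbors G (\<phi> v). g (\<phi> v) \<le> g u"
    using av \<phi>V[OF q] unfolding avoidable_def by blast
  have "\<phi> u \<in> neighbors G (\<phi> v)" if "u \<in> neighbors G v" for u
    using that \<phi>V count_edges_automorphism[OF G \<phi> v]
    by (simp add: neighbors_def adjacent_def flip: count_greater_zero_iff)
  then show "\<exists>g. (\<forall>x \<in> verts G. laplacian G g x \<le> (D \<circ> \<phi>) x) \<and>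
      laplacian G g q < (D \<circ> \<phi>) q \<and> (\<forall>u \<in> neighbors G v. g v \<le> g u)"
    using g \<phi>V q by (intro exI[of _ "g \<circ> \<phi>"]) (auto simp: laplacian_automorphism[OF G \<phi>])
qed

section \<open>Deleting a vertex and pairing its neighbors\<close>

lemma finite_loopless_delete_and_pair:
  assumes G: "finite_loopless_multigraph G" and P: "pairing (neighbors G v) P"
  shows "finite_loopless_multigraph (delete_and_pair G v P)" "finite P"
proof -
  have fin: "finite (neighbors G v)"
    using G by (simp add: finite_loopless_multigraph_def neighbors_def)
  have un: "\<Union>P = neighbors G v" and two: "\<forall>p \<in> P. card p = 2"
    using P by (auto simp: pairing_def partition_on_def)
  show "finite P"
    using fin un by (metis finite_UnionD)
  moreover have "v \<notin> neighbors G v"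
    using count_loop[OF G, of v] by (auto simp: neighbors_def adjacent_def count_eq_zero_iff)
  moreover have "neighbors G v \<subseteq> verts G"
    by (auto simp: neighbors_def)
  ultimately show "finite_loopless_multigraph (delete_and_pair G v P)"
    using G un two unfolding finite_loopless_multigraph_def delete_and_pair_def by auto
qed

text \<open>A neighbor \<open>u\<close> of \<open>v\<close> now loses \<open>g u - g u'\<close> to
  its partner \<open>u'\<close> in place of \<open>g u - g v\<close> per edge to \<open>v\<close>,
  and \<open>g v \<le> g u'\<close>. At other vertices nothing changes.\<close>

lemma laplacian_delete_and_pair_le:
  assumes G: "finite_loopless_multigraph G" and P: "pairing (neighbors G v) P"
    and v: "v \<in> verts G" and u: "u \<in> verts G" "u \<noteq> v"
    and min: "\<forall>u \<in> neighbors G v. g v \<le> g u"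
  shows "laplacian (delete_and_pair G v P) g u \<le> laplacian G g u"
proof -
  let ?c = "\<lambda>x. int (count (edges G) {u, x})"
  let ?p = "\<lambda>x. if {u, x} \<in> P then g u - g x else 0"
  have fin: "finite (verts G)"
    using G by (simp add: finite_loopless_multigraph_def)
  have finP: "finite P"
    by (rule finite_loopless_delete_and_pair(2)[OF G P])
  have un: "\<Union>P = neighbors G v" and two: "\<forall>p \<in> P. card p = 2" and disj: "disjoint P"
    using P by (auto simp: pairing_def partition_on_def)
  have new: "(\<Sum>x \<in> verts G - {v}. ?p x) \<le> ?c v * (g u - g v)"
  proof (cases "u \<in> neighbors G v")
    case True
    then obtain p where p: "p \<in> P" "u \<in> p"
      using un by blast
    then obtain u' where u': "p = {u, u'}" "u' \<noteq> u"
      using two by (metis card_2_iff doubleton_eq_iff insertE singletonD)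
    have u'N: "u' \<in> neighbors G v"
      using p u' un by auto
    \<comment> \<open>The pairs are disjoint, so the one containing \<open>u\<close> is
      unique.\<close>
    have partner: "{u, x} \<in> P \<longleftrightarrow> x = u'" for x
    proof
      assume "{u, x} \<in> P"
      then have "{u, x} = {u, u'}"
        using disjointD[OF disj, of "{u, x}" p] p u'(1) by blast
      then show "x = u'"
        by (auto simp: doubleton_eq_iff)
    qed (use p u' in auto)
    have "u' \<in> verts G - {v}"
      using u'N count_loop[OF G, of v] by (auto simp: neighbors_def adjacent_def count_eq_zero_iff)
    then have "(\<Sum>x \<in> verts G - {v}. ?p x) = g u - g u'"
      using fin by (simp add: partner)
    also have "\<dots> \<le> g u - g v"
      using min u'N by simp
    \<comment> \<open>The multiplicity is at least 1 and \<open>g u - g v\<close> is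
      nonnegative.\<close>
    also have "\<dots> \<le> ?c v * (g u - g v)"
    proof -
      have "1 \<le> ?c v"
        using True by (simp add: neighbors_def adjacent_def insert_commute Suc_leI)
      then show ?thesis
        using min True mult_right_mono[of 1 "?c v" "g u - g v"] by simp
    qed
    finally show ?thesis .
  next
    case False
    then have "?c v = 0"
      using u by (simp add: neighbors_def adjacent_def insert_commute count_eq_zero_iff)
    moreover have "{u, x} \<notin> P" for x
      using False un by blast
    ultimately show ?thesis
      by simp
  qed
  \<comment> \<open>Each pair in \<open>P\<close> adds exactly 1 to the multiplicity of its edge,
    also when that edge was already present.\<close>
  have "laplacian (delete_and_pair G v P) g u
      = (\<Sum>x \<in> verts G - {v}. ?c x * (g u - g x) + ?p x)"
    unfolding laplacian_def using u finP
    by (intro sum.cong) (auto simp: delete_and_pair_def algebra_simps)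
  also have "\<dots> = (\<Sum>x \<in> verts G - {v}. ?c x * (g u - g x)) + (\<Sum>x \<in> verts G - {v}. ?p x)"
    by (rule sum.distrib)
  also have "\<dots> \<le> (\<Sum>x \<in> verts G - {v}. ?c x * (g u - g x)) + ?c v * (g u - g v)"
    using new by simp
  also have "\<dots> = laplacian G g u"
    unfolding laplacian_def using sum.remove[OF fin v, of "\<lambda>x. ?c x * (g u - g x)"] by simp
  finally show ?thesis .
qed

text \<open>The restriction of \<open>D\<close> has positive rank by the same scripts, since no
  remaining vertex loses more chips than in \<open>G\<close>. Dropping the chips on \<open>v\<close>
  cannot raise the degree.\<close>

lemma gon_delete_and_pair_le:
  assumes G: "finite_loopless_multigraph G" and v: "v \<in> verts G"
    and P: "pairing (neighbors G v) P" and D: "effective G D" "avoidable G D v"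
  shows "gon (delete_and_pair G v P) \<le> degree G D"
proof -
  let ?H = "delete_and_pair G v P"
  let ?D = "\<lambda>x. if x \<in> verts G - {v} then D x else 0"
  note H = finite_loopless_delete_and_pair(1)[OF G P]
  have VH: "verts ?H = verts G - {v}"
    by (simp add: delete_and_pair_def)
  have "positive_rank ?H ?D"
    unfolding positive_rank_iff[OF H]
  proof
    fix q assume q: "q \<in> verts ?H"
    then obtain g where g: "\<forall>x \<in> verts G. laplacian G g x \<le> D x" "laplacian G g q < D q"
      "\<forall>u \<in> neighbors G v. g v \<le> g u"
      using D(2) VH unfolding avoidable_def by blast
    have "laplacian ?H g x \<le> laplacian G g x" if "x \<in> verts ?H" for x
      using laplacian_delete_and_pair_le[OF G P v _ _ g(3)] that VH by simp
    then show "\<exists>g. (\<forall>x \<in> verts ?H. laplacian ?H g x \<le> ?D x) \<and> laplacian ?H g q < ?D q"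
      using g q VH by (intro exI[of _ g]) force
  qed
  then have "gon ?H \<le> degree ?H ?D"
    by (intro gon_le[OF H]) (auto simp: divisor_def VH)
  also have "\<dots> = (\<Sum>x \<in> verts G - {v}. D x)"
    by (simp add: degree_def VH)
  also have "\<dots> \<le> degree G D"
    unfolding degree_def using G D(1) by (intro sum_mono2)
      (auto simp: finite_loopless_multigraph_def effective_def)
  finally show ?thesis .
qed

theorem theorem4p1:
  fixes G H :: "'a multigraph" and v :: 'a and P :: "'a set set"
  assumes "finite_loopless_multigraph G"
    and "connected_multigraph G"
    and "simple_multigraph G"
    and "vertex_transitive G"
    and "\<forall>u \<in> verts G. even (valence G u)"
    and "v \<in> verts G"
    and "pairing (neighbors G v) P"
    and "H = delete_and_pair G v P"
  shows "gon H \<le> gon G"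
proof -
  note G = \<open>finite_loopless_multigraph G\<close> and v = \<open>v \<in> verts G\<close>
  obtain D0 where D0: "positive_rank G D0" "degree G D0 = gon G"
    using exists_positive_rank[OF G] gon_attained[OF G] by metis
  then obtain D where D: "effective G D" "positive_rank G D" "degree G D = gon G"
    by (metis positive_rank_effective_representative[OF G])
  \<comment> \<open>The avoidable vertex depends on \<open>D\<close>, so an automorphism taking
    \<open>v\<close> to \<open>w\<close> is used to pull \<open>D\<close> back.\<close>
  obtain w where w: "w \<in> verts G" "avoidable G D w"
    using exists_avoidable[OF G _ D(1,2)] v by blast
  obtain \<phi> where \<phi>: "automorphism G \<phi>" "\<phi> v = w"
    using \<open>vertex_transitive G\<close> v w(1) unfolding vertex_transitive_def by blast
  have bij: "bij_betw \<phi> (verts G) (verts G)"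
    using \<phi>(1) by (simp add: automorphism_def)
  have "effective G (D \<circ> \<phi>)"
    using D(1) bij by (auto simp: effective_def bij_betw_def)
  moreover have "avoidable G (D \<circ> \<phi>) v"
    using avoidable_automorphism[OF G \<phi>(1) v] w(2) \<phi>(2) by simp
  ultimately have "gon H \<le> degree G (D \<circ> \<phi>)"
    using gon_delete_and_pair_le[OF G v \<open>pairing (neighbors G v) P\<close>]
      \<open>H = delete_and_pair G v P\<close> by simp
  also have "\<dots> = degree G D"
    unfolding degree_def using sum.reindex_bij_betw[OF bij, of D] by simp
  finally show ?thesis
    using D(3) by simp
qed

end
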